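(* Let $G=(N,E)$ be a finite directed graph, $T\ge1$ an integer, $H:\mathbb R^E_{\ge0}\times\mathbb Z_{\ge1}\to\mathbb R$ a time dependent potential, and for each integer $T'\ge 1$ let $H^{T'}(i)=\sum_{t=1}^{T'}H(i(t),t)$. Let $i\in\mathbb R^{E^{T,\Omega}}_{\ge0}$ be such that for some $u\in\mathbb R^{N^{T,\Omega}}$ $$\min\{i,\nabla H^T(i)-Du\}=0\text{ in }E^{T,\Omega},\qquad \operatorname{div}i=0\text{ in }N\times\{1,\dots,T\}.$$ Let $j\in\mathbb R^{E^{T+1,\Omega}}_{\ge0}$ be the extension of $i$ by zero (equal to $i$ on $E^{T,\Omega}$ and $0$ on $E^{T+1,\Omega}\setminus E^{T,\Omega}$), and let $\xi=\nabla H^{T+1}(j)$. Then there exists $v\in\mathbb R^{N^{T+1,\Omega}}$ such that $$\min\{j,\nabla H^{T+1}(j)-Dv\}=0\text{ in }E^{T+1,\Omega}$$ if and only if for every $k\ge1$ and every $e_1=(x_1,y_1),\dots,e_k=(x_k,y_k)\in E$, with $e_{k+1}:=e_1$ (so $x_{k+1}=x_1$), one has $$\sum_{l=1}^k\Big(\partial_{e_l}H(0,T+1)+d_{\operatorname{Sym}_{\{i>0\}}[\xi]}\big((y_l,\Omega),(x_{l+1},T)\big)\Big)\ge0,$$ where the distance is taken in the symmetrized graph $\operatorname{Sym}_{\{i>0\}}(G^{T,\Omega})$ with respect to the symmetrization of the restriction of $\xi$ to $E^{T,\Omega}$.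
   Context: A directed graph is $G=(N,E)$ with $N$ finite and $E\subseteq N\times N$; for an edge $e=(x,y)$, $e^-=x$, $e^+=y$, $-e=(y,x)$. $\mathbb R^X$ is the set of functions $X\to\mathbb R$. On any directed graph, $\operatorname{div}i(x)=\sum_{e^-=x}i(e)-\sum_{e^+=x}i(e)$ and $Du(e)=u(e^+)-u(e^-)$. Minima in equations are coordinatewise. Extended graphs: for an integer $T\ge1$, $N^T=N\times\{0,\dots,T\}$, and $E^T$ consists of the edges $(e,t):=((x,t-1),(y,t))$ for $e=(x,y)\in E$, $t\in\{1,\dots,T\}$. With a symbol $\Omega$, $N^\Omega=N\times\{\Omega\}$, and $N^{T,\Omega}=N^T\cup N^\Omega$, $E^{T,\Omega}=E^T\cup\{((x,t),(x,\Omega)): x\in N,\ t\in\{1,\dots,T\}\}$, $G^{T,\Omega}=(N^{T,\Omega},E^{T,\Omega})$. For $i\in\mathbb R^{E^{T,\Omega}}$ and $t\in\{1,\dots,T\}$, $i(t)\in\mathbb R^E$ denotes $e\mapsto i(e,t)$. A time dependent potential is a function $H:\mathbb R^E_{\ge0}\times\mathbb Z_{\ge1}\to\mathbb R$ with each $H(\cdot,t)$ continuously differentiable (up to the boundary); $\partial_eH(i,t)$ is the derivative in the coordinate $i_e$. $H^T$ is regarded as a function on $\mathbb R^{E^{T,\Omega}}_{\ge0}$ independent of the coordinates of edges ending in $N^\Omega$, so $\partial_{(e,t)}H^T(i)=\partial_eH(i(t),t)$ and $\nabla H^T=0$ on edges ending in $N^\Omega$. Symmetrization: for a directed graph with edge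 set $E'$ and $S\subseteq E'$, $\operatorname{Sym}_S$ of the graph has the same nodes and edge set $E'\cup\{-e:e\in S\}$; for $\xi:E'\to\mathbb R$, $\operatorname{Sym}_S[\xi](e)=\xi(e)$ if $e\in E'$, and $=-\xi(-e)$ if $e\notin E'$, $-e\in S$. (In $G^{T,\Omega}$ no edge has its reverse in the edge set.) For a real-valued (unsigned) metric $\zeta$ on a graph, $d_\zeta(x,y)$ is the infimum over paths $\omega$ from $x$ to $y$ (finite lists of consecutive edges, possibly empty if $x=y$) of $\sum_{e\in\omega}\zeta(e)$ counted with multiplicity, and $+\infty$ if there is no such path. *)

theory Defs
  imports
    "HOL-Analysis.Analysis"
    "Graph_Theory.Pair_Digraph"
    "Graph_Theory.Shortest_Path"
begin

text \<open>
  A directed graph $(N,E)$ with $E \subseteq N \times N$ is a \<^typ>\<open>'a pair_pre_digraph\<close>; loops are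
  allowed, and finiteness and $E \subseteq N \times N$ are the locale predicate
  \<^const>\<open>pair_fin_digraph\<close>.  The space of functions from X to the reals is
  \<open>X \<rightarrow>\<^sub>E UNIV\<close>, and its nonnegative orthant is \<open>X \<rightarrow>\<^sub>E {0..}\<close>.
\<close>

definition divergence :: "'a pair_pre_digraph \<Rightarrow> ('a \<times> 'a \<Rightarrow> real) \<Rightarrow> 'a \<Rightarrow> real" where
  "divergence G i x =
     (\<Sum>e\<in>out_arcs (with_proj G) x. i e) - (\<Sum>e\<in>in_arcs (with_proj G) x. i e)"

definition node_diff :: "('a \<Rightarrow> real) \<Rightarrow> 'a \<times> 'a \<Rightarrow> real" where
  "node_diff u e = u (snd e) - u (fst e)"


section \<open>Extended graphs\<close>

datatype stage = Level nat | Omega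

definition timed_edge :: "'a \<times> 'a \<Rightarrow> nat \<Rightarrow> ('a \<times> stage) \<times> ('a \<times> stage)" where
  "timed_edge e t = ((fst e, Level (t - 1)), (snd e, Level t))"

definition ext_graph :: "'a pair_pre_digraph \<Rightarrow> nat \<Rightarrow> ('a \<times> stage) pair_pre_digraph" where
  "ext_graph G T =
     \<lparr> pverts = pverts G \<times> Level ` {0..T},
       parcs = {timed_edge e t | e t. e \<in> parcs G \<and> t \<in> {1..T}} \<rparr>"

definition ext_graph_Omega :: "'a pair_pre_digraph \<Rightarrow> nat \<Rightarrow> ('a \<times> stage) pair_pre_digraph" where
  "ext_graph_Omega G T =
     \<lparr> pverts = pverts (ext_graph G T) \<union> pverts G \<times> {Omega},
       parcs = parcs (ext_graph G T) \<union>
         {((x, Level t), (x, Omega)) | x t. x \<in> pverts G \<and> t \<in> {1..T}} \<rparr>"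

definition slice ::
  "'a pair_pre_digraph \<Rightarrow> (('a \<times> stage) \<times> ('a \<times> stage) \<Rightarrow> real) \<Rightarrow> nat \<Rightarrow> ('a \<times> 'a \<Rightarrow> real)" where
  "slice G i t = (\<lambda>e\<in>parcs G. i (timed_edge e t))"


section \<open>Potentials\<close>

text \<open>
  Partial derivative, in the coordinate \<open>e\<close>, of a function on the nonnegative orthant; it is
  one-sided at points with \<open>i e = 0\<close>.
\<close>

definition partial_deriv :: "(('e \<Rightarrow> real) \<Rightarrow> real) \<Rightarrow> ('e \<Rightarrow> real) \<Rightarrow> 'e \<Rightarrow> real" where
  "partial_deriv F i e = vector_derivative (\<lambda>s. F (i(e := s))) (at (i e) within {0..})"

text \<open>
  Continuously differentiable up to the boundary: all partial derivatives exist and are continuous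
  on the closed orthant.  For finite \<open>X\<close> this includes continuity of \<open>F\<close> and total
  differentiability.  Continuity refers to the product topology on functions, which on
  \<open>X \<rightarrow>\<^sub>E {0..}\<close> is the Euclidean one.
\<close>

definition C1_on_orthant :: "'e set \<Rightarrow> (('e \<Rightarrow> real) \<Rightarrow> real) \<Rightarrow> bool" where
  "C1_on_orthant X F \<longleftrightarrow>
     (\<forall>e\<in>X.
        (\<forall>i\<in>X \<rightarrow>\<^sub>E {0..}. (\<lambda>s. F (i(e := s))) differentiable (at (i e) within {0..})) \<and>
        continuous_on (X \<rightarrow>\<^sub>E {0..}) (\<lambda>i. partial_deriv F i e))"

definition time_dependent_potential ::
  "'a pair_pre_digraph \<Rightarrow> (('a \<times> 'a \<Rightarrow> real) \<Rightarrow> nat \<Rightarrow> real) \<Rightarrow> bool" where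
  "time_dependent_potential G H \<longleftrightarrow> (\<forall>t\<ge>1. C1_on_orthant (parcs G) (\<lambda>i. H i t))"

definition total_potential ::
  "'a pair_pre_digraph \<Rightarrow> (('a \<times> 'a \<Rightarrow> real) \<Rightarrow> nat \<Rightarrow> real) \<Rightarrow> nat \<Rightarrow>
     (('a \<times> stage) \<times> ('a \<times> stage) \<Rightarrow> real) \<Rightarrow> real" where
  "total_potential G H T i = (\<Sum>t=1..T. H (slice G i t) t)"


section \<open>Symmetrization and distance\<close>

text \<open>The reversed edge $-e$ is \<open>prod.swap e\<close>.\<close>

definition sym_graph :: "('a \<times> 'a) set \<Rightarrow> 'a pair_pre_digraph \<Rightarrow> 'a pair_pre_digraph" where
  "sym_graph S G = \<lparr> pverts = pverts G, parcs = parcs G \<union> prod.swap ` S \<rparr>"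

definition sym_fun ::
  "('a \<times> 'a) set \<Rightarrow> 'a pair_pre_digraph \<Rightarrow> ('a \<times> 'a \<Rightarrow> real) \<Rightarrow> ('a \<times> 'a \<Rightarrow> real)" where
  "sym_fun S G \<xi> =
     (\<lambda>e\<in>parcs (sym_graph S G). if e \<in> parcs G then \<xi> e else - \<xi> (prod.swap e))"

text \<open>
  The library's \<open>\<mu>\<close> is the infimum, in the extended reals, of the costs of all walks (lists of
  consecutive arcs, with repetitions allowed); it is \<open>\<infinity>\<close> if there is no walk.
\<close>

definition graph_dist ::
  "'a pair_pre_digraph \<Rightarrow> ('a \<times> 'a \<Rightarrow> real) \<Rightarrow> 'a \<Rightarrow> 'a \<Rightarrow> ereal" where
  "graph_dist G \<zeta> x y = wf_digraph.\<mu> (with_proj G) \<zeta> x y"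

end

theory Submission
  imports Defs
begin

text \<open>
  The complementarity conditions say that \<open>v\<close> is a potential for the symmetrized weights: the arcs give
  \<open>Dv \<le> \<xi>\<close>, the reversed arcs turn this into equality where the flow is positive.  Passing from
  \<open>T\<close> to \<open>T + 1\<close> amounts to adding to the old symmetrized graph, for every \<open>(x, y) \<in> E\<close>, an arc from
  \<open>(x, T)\<close> to \<open>(y, \<Omega>)\<close> of weight \<open>\<partial>H(0, T + 1)\<close>.  A potential exists iff there is no negative cycle;
  the old graph has none because it carries the potential \<open>u\<close>, and a cycle through the new arcs
  \<open>e\<^sub>1, \<dots>, e\<^sub>k\<close> is optimally completed by shortest walks in the old graph.
\<close>

section \<open>Potentials and distances in weighted digraphs\<close>

text \<open>These are the dual constraints of the shortest path problem. Stated in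
  \<open>pre_digraph\<close>, they can be written for symmetrized graphs without first establishing
  well-formedness.\<close>

definition (in pre_digraph) feasible_potential :: "('b \<Rightarrow> real) \<Rightarrow> ('a \<Rightarrow> real) \<Rightarrow> bool" where
  "feasible_potential c \<phi> \<longleftrightarrow> (\<forall>a\<in>arcs G. \<phi> (head G a) - \<phi> (tail G a) \<le> c a)"

text \<open>The potential differences telescope along the walk.\<close>

lemma (in wf_digraph) feasible_potential_le_awalk_cost:
  assumes "feasible_potential c \<phi>" "awalk x p y"
  shows "\<phi> y - \<phi> x \<le> awalk_cost c p"
  using assms(2)
proof (induction p arbitrary: x)
  case Nil
  then show ?case by (simp add: awalk_Nil_iff)
next
  case (Cons a p)
  then have "\<phi> y - \<phi> (head G a) \<le> awalk_cost c p" "a \<in> arcs G" "tail G a = x"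
    by (auto simp: awalk_Cons_iff)
  with assms(1) show ?case
    by (fastforce simp: feasible_potential_def)
qed

text \<open>A single feasible potential bounds every distance from below, so none can be
  -\<infinity>.\<close>

lemma (in wf_digraph) feasible_potential_le_\<mu>:
  assumes "feasible_potential c \<phi>"
  shows "ereal (\<phi> y - \<phi> x) \<le> \<mu> c x y"
  unfolding \<mu>_def by (rule INF_greatest) (use assms feasible_potential_le_awalk_cost in auto)

text \<open>The witness at \<open>y\<close> is the infimum of the costs of walks ending at
  \<open>y\<close> with arbitrary start, so the empty walk is always a candidate at a vertex.
  Removing cycles never raises a cost, hence the finitely many paths give a lower bound.\<close>

lemma (in fin_digraph) ex_feasible_potential:
  assumes no_neg_cycle: "\<And>x p. awalk x p x \<Longrightarrow> awalk_cost c p \<ge> 0"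
  shows "\<exists>\<phi>. feasible_potential c \<phi>"
proof -
  define costs where "costs y = {awalk_cost c p | p x. awalk x p y}" for y
  have bdd: "bdd_below (costs y)" for y
  proof -
    have "finite (awalk_cost c ` (\<lambda>(x, p, y). p) ` {(x, p, y). apath x p y})"
      using apaths_finite_triple by blast
    then obtain m where m: "\<And>x p y. apath x p y \<Longrightarrow> m \<le> awalk_cost c p"
      using bdd_below_finite unfolding bdd_below_def by (fastforce simp: image_iff)
    have "m \<le> awalk_cost c p" if "awalk x p y" for x p
      using m[OF apath_awalk_to_apath[OF that]] awalk_to_path_no_neg_cyc_cost[OF that, of c]
        no_neg_cycle by (meson linorder_not_less order_trans)
    then show ?thesis by (auto simp: costs_def bdd_below_def)
  qed
  have "Inf (costs (head G a)) - Inf (costs (tail G a)) \<le> c a" if "a \<in> arcs G" for a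
  proof -
    have "Inf (costs (head G a)) - c a \<le> Inf (costs (tail G a))"
    proof (rule cInf_greatest)
      have "awalk (tail G a) [] (tail G a)"
        using that by (simp add: awalk_Nil_iff)
      then show "costs (tail G a) \<noteq> {}" by (auto simp: costs_def)
    next
      fix r assume "r \<in> costs (tail G a)"
      then obtain x p where p: "awalk x p (tail G a)" "r = awalk_cost c p"
        by (auto simp: costs_def)
      have "awalk x (p @ [a]) (head G a)"
        using p(1) that by (intro awalk_appendI[OF p(1)]) (simp add: awalk_simps)
      then have "awalk_cost c (p @ [a]) \<in> costs (head G a)"
        unfolding costs_def by blast
      then show "Inf (costs (head G a)) - c a \<le> r"
        using cInf_lower[OF _ bdd] p(2) by fastforce
    qed
    then show ?thesis by simp
  qed
  then show ?thesis
    by (intro exI[of _ "\<lambda>y. Inf (costs y)"]) (simp add: feasible_potential_def)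
qed

section \<open>Potentials subject to additional arcs\<close>

lemma pcas_nth:
  assumes "pcas x p y" "l < length p"
  shows "p ! l = (pawalk_verts x p ! l, pawalk_verts x p ! Suc l)"
  using assms
proof (induction p arbitrary: x l)
  case Nil
  then show ?case by simp
next
  case (Cons a p)
  then show ?case
    by (cases l; cases p) (auto simp: prod_eq_iff)
qed

text \<open>
  The closed walks of the auxiliary digraph on \<open>E\<close>, whose arc from \<open>a\<close> to \<open>b\<close> weighs
  \<open>w a + \<mu> c (t a) (s b)\<close>, are exactly the cyclic sequences in the criterion; a potential \<open>\<phi>\<close> on it
  prescribes the values at the points \<open>s e\<close>.
\<close>

lemma (in wf_digraph) feasible_potential_extra_arcs_iff:
  fixes s t :: "'e \<Rightarrow> 'a" and w :: "'e \<Rightarrow> real"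
  assumes fin: "finite E" and t: "t ` E \<subseteq> verts G" and u: "feasible_potential c u"
  shows "(\<exists>v. feasible_potential c v \<and> (\<forall>e\<in>E. v (t e) - v (s e) \<le> w e)) \<longleftrightarrow>
    (\<forall>k\<ge>1. \<forall>e :: nat \<Rightarrow> 'e. (\<forall>l\<in>{1..k}. e l \<in> E) \<and> e (Suc k) = e 1 \<longrightarrow>
      (\<Sum>l=1..k. ereal (w (e l)) + \<mu> c (t (e l)) (s (e (Suc l)))) \<ge> 0)"
    (is "?L \<longleftrightarrow> ?R")
proof
  assume ?L
  then obtain v where v: "feasible_potential c v" "\<forall>e\<in>E. v (t e) - v (s e) \<le> w e"
    by blast
  show ?R
  proof (intro allI impI, elim conjE)
    fix k :: nat and e :: "nat \<Rightarrow> 'e"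
    assume k: "k \<ge> 1" and e: "\<forall>l\<in>{1..k}. e l \<in> E" "e (Suc k) = e 1"
    \<comment> \<open>The sum telescopes to zero because the sequence closes up at
      \<open>e (Suc k) = e 1\<close>.\<close>
    have "(\<Sum>l=1..k. v (s (e (Suc l))) - v (s (e l))) = 0"
      using k e(2) sum_Suc_diff[of 1 k "\<lambda>l. v (s (e l))"] by simp
    then have "0 = (\<Sum>l=1..k. ereal (v (s (e (Suc l))) - v (s (e l))))"
      by (simp del: ereal_minus)
    also have "\<dots> \<le> (\<Sum>l=1..k. ereal (w (e l)) + \<mu> c (t (e l)) (s (e (Suc l))))"
    proof (rule sum_mono)
      fix l assume "l \<in> {1..k}"
      then have "v (t (e l)) - v (s (e l)) \<le> w (e l)" using v(2) e(1) by blast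
      then have "ereal (v (s (e (Suc l))) - v (s (e l)))
          \<le> ereal (w (e l)) + ereal (v (s (e (Suc l))) - v (t (e l)))"
        by simp
      also have "\<dots> \<le> ereal (w (e l)) + \<mu> c (t (e l)) (s (e (Suc l)))"
        by (intro add_left_mono feasible_potential_le_\<mu> v(1))
      finally show "ereal (v (s (e (Suc l))) - v (s (e l)))
          \<le> ereal (w (e l)) + \<mu> c (t (e l)) (s (e (Suc l)))" .
    qed
    finally show "0 \<le> (\<Sum>l=1..k. ereal (w (e l)) + \<mu> c (t (e l)) (s (e (Suc l))))" .
  qed
next
  assume R: ?R
  \<comment> \<open>Pairs at infinite distance get no arc: they constrain nothing, and
    \<open>real_of_ereal\<close> would turn \<infinity> into 0.\<close>
  define K where "K = \<lparr>pverts = E, parcs = {(a, b) \<in> E \<times> E. \<mu> c (t a) (s b) < \<infinity>}\<rparr>"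
  define d where "d = (\<lambda>(a, b). w a + real_of_ereal (\<mu> c (t a) (s b)))"
  have d: "ereal (d (a, b)) = ereal (w a) + \<mu> c (t a) (s b)" if "(a, b) \<in> parcs K" for a b
  proof -
    have "\<mu> c (t a) (s b) < \<infinity>" using that by (simp add: K_def)
    moreover have "\<mu> c (t a) (s b) \<noteq> - \<infinity>"
      using feasible_potential_le_\<mu>[OF u, of "s b" "t a"] by auto
    ultimately show ?thesis
      by (cases "\<mu> c (t a) (s b)") (auto simp: d_def)
  qed
  have "finite (parcs K)"
    by (rule finite_subset[of _ "E \<times> E"]) (auto simp: K_def fin)
  then interpret K: pair_fin_digraph K
    by unfold_locales (auto simp: K_def fin)
  have "K.awalk_cost d p \<ge> 0" if walk: "K.awalk x p x" for x p
  proof (cases "p = []")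
    case False
    \<comment> \<open>The shift numbers the nodes of the closed walk from 1, as in the criterion;
      the last one is \<open>e (Suc (length p))\<close>.\<close>
    define e where "e l = pawalk_verts x p ! (l - 1)" for l
    have p: "set p \<subseteq> parcs K" "pcas x p x"
      using walk unfolding K.awalk_def by auto
    have nth: "p ! (l - 1) = (e l, e (Suc l))" if "l \<in> {1..length p}" for l
    proof -
      have "l - 1 < length p" "Suc (l - 1) = l" using that by auto
      then show ?thesis using pcas_nth[OF p(2), of "l - 1"] by (simp add: e_def)
    qed
    have arc: "(e l, e (Suc l)) \<in> parcs K" if "l \<in> {1..length p}" for l
    proof -
      have "p ! (l - 1) \<in> set p" using that by (intro nth_mem) auto
      then show ?thesis using nth[OF that] p(1) by auto
    qed
    have len: "length (pawalk_verts x p) = Suc (length p)"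
      by (induction p arbitrary: x) auto
    have "e 1 = x"
      using K.awhd_of_awalk[OF walk] len by (simp add: e_def hd_conv_nth[symmetric])
    moreover have "e (Suc (length p)) = x"
      using K.awlast_of_awalk[OF walk] len by (simp add: e_def last_conv_nth)
    ultimately have closed: "e (Suc (length p)) = e 1" by simp
    have "\<forall>l\<in>{1..length p}. e l \<in> E" using arc by (auto simp: K_def)
    with R closed False
    have "0 \<le> (\<Sum>l=1..length p. ereal (w (e l)) + \<mu> c (t (e l)) (s (e (Suc l))))"
      by (auto simp: Suc_le_eq)
    also have "\<dots> = (\<Sum>l=1..length p. ereal (d (p ! (l - 1))))"
      by (intro sum.cong refl) (simp only: nth d[OF arc])
    also have "\<dots> = ereal (\<Sum>l=1..length p. d (p ! (l - 1)))" by simp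
    also have "(\<Sum>l=1..length p. d (p ! (l - 1))) = (\<Sum>l<length p. d (p ! l))"
      by (rule sum.reindex_bij_witness[of _ Suc "\<lambda>l. l - 1"]) auto
    also have "\<dots> = K.awalk_cost d p"
      by (simp add: K.awalk_cost_def sum_list_sum_nth atLeast0LessThan)
    finally show ?thesis by simp
  qed simp
  then obtain \<phi> where \<phi>: "K.feasible_potential d \<phi>"
    using K.ex_feasible_potential by blast
  \<comment> \<open>Both constants exist since \<open>E\<close> is finite. \<open>M + u\<close> lies
    above \<open>\<phi>\<close> at every \<open>s e\<close>, and \<open>m + u\<close> lies below the
    cost of every walk that starts with an additional arc.\<close>
  obtain M where M: "\<phi> e - u (s e) \<le> M" if "e \<in> E" for e
    using bdd_above_finite[OF finite_imageI[OF fin], of "\<lambda>e. \<phi> e - u (s e)"]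
    by (auto simp: bdd_above_def)
  obtain m where m: "m \<le> \<phi> e + w e - u (t e)" if "e \<in> E" for e
    using bdd_below_finite[OF finite_imageI[OF fin], of "\<lambda>e. \<phi> e + w e - u (t e)"]
    by (auto simp: bdd_below_def)
  \<comment> \<open>Candidate values at \<open>x\<close>: start from the prescribed value at
    \<open>s e\<close>, cross the additional arc, then follow a walk to \<open>x\<close>. The extra
    candidate \<open>M + u x\<close> keeps the set nonempty where no such walk arrives.\<close>
  define vals where
    "vals x = insert (M + u x) {\<phi> e + w e + awalk_cost c p | e p. e \<in> E \<and> awalk (t e) p x}" for x
  have "min M m + u x \<le> r" if "r \<in> vals x" for x r
  proof -
    have "min M m + u x \<le> \<phi> e + w e + awalk_cost c p" if "e \<in> E" "awalk (t e) p x" for e p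
      using m[OF that(1)] feasible_potential_le_awalk_cost[OF u that(2)] by linarith
    with that show ?thesis unfolding vals_def by auto
  qed
  then have lower: "Inf (vals x) \<le> r" if "r \<in> vals x" for x r
    using that by (meson bdd_belowI cInf_lower)
  have ne: "vals x \<noteq> {}" for x by (simp add: vals_def)
  have "Inf (vals (head G a)) - Inf (vals (tail G a)) \<le> c a" if a: "a \<in> arcs G" for a
  proof -
    have "Inf (vals (head G a)) - c a \<le> r" if "r \<in> vals (tail G a)" for r
      using that[unfolded vals_def]
    proof (elim insertE CollectE exE conjE)
      assume "r = M + u (tail G a)"
      moreover have "u (head G a) - u (tail G a) \<le> c a"
        using u a by (simp add: feasible_potential_def)
      ultimately show ?thesis
        using lower[of "M + u (head G a)" "head G a"] unfolding vals_def by auto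
    next
      fix e p assume r: "r = \<phi> e + w e + awalk_cost c p" and "e \<in> E" "awalk (t e) p (tail G a)"
      moreover from this have "awalk (t e) (p @ [a]) (head G a)"
        by (intro awalk_appendI) (auto simp: a awalk_simps)
      ultimately have "\<phi> e + w e + awalk_cost c (p @ [a]) \<in> vals (head G a)"
        unfolding vals_def by blast
      from lower[OF this] show ?thesis using r by simp
    qed
    then show ?thesis
      using cInf_greatest[OF ne, of "tail G a" "Inf (vals (head G a)) - c a"] by auto
  qed
  then have "feasible_potential c (\<lambda>x. Inf (vals x))"
    by (simp add: feasible_potential_def)
  \<comment> \<open>It suffices that the value is at most \<open>\<phi> e + w e\<close> at
    \<open>t e\<close> and at least \<open>\<phi> e\<close> at \<open>s e\<close>.\<close>
  moreover have "Inf (vals (t e)) - Inf (vals (s e)) \<le> w e" if e: "e \<in> E" for e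
  proof -
    have "awalk (t e) [] (t e)" using t e by (auto simp: awalk_Nil_iff)
    then have "\<phi> e + w e + awalk_cost c [] \<in> vals (t e)" using e unfolding vals_def by blast
    then have 1: "Inf (vals (t e)) \<le> \<phi> e + w e" using lower by fastforce
    have "\<phi> e \<le> r" if "r \<in> vals (s e)" for r
      using that[unfolded vals_def]
    proof (elim insertE CollectE exE conjE)
      fix e' p assume r: "r = \<phi> e' + w e' + awalk_cost c p" and e': "e' \<in> E" "awalk (t e') p (s e)"
      \<comment> \<open>The walk makes the distance finite, so \<open>(e', e)\<close> is an arc of
        \<open>K\<close> and its constraint on \<open>\<phi>\<close> is available.\<close>
      have \<mu>: "\<mu> c (t e') (s e) \<le> awalk_cost c p" using min_cost_le_walk_cost e'(2) .
      then have arc: "(e', e) \<in> parcs K" using e e'(1) by (auto simp: K_def)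
      have "ereal (d (e', e)) \<le> ereal (w e') + ereal (awalk_cost c p)"
        unfolding d[OF arc] by (intro add_left_mono \<mu>)
      moreover have "\<phi> e - \<phi> e' \<le> d (e', e)"
        using \<phi> arc by (fastforce simp: K.feasible_potential_def)
      ultimately show ?thesis using r by simp
    qed (use M[OF e] in simp)
    then have "\<phi> e \<le> Inf (vals (s e))" by (intro cInf_greatest ne)
    with 1 show ?thesis by simp
  qed
  ultimately show ?L by blast
qed

section \<open>The time-extended graph\<close>

lemma timed_edge_eq_iff [simp]: "timed_edge e t = timed_edge e' t' \<longleftrightarrow> e = e' \<and> t = t'"
  by (auto simp: timed_edge_def prod_eq_iff)

lemma timed_edge_neq_Omega [simp]: "timed_edge e t \<noteq> (p, (x, Omega))"
  "(p, (x, Omega)) \<noteq> timed_edge e t"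
  by (auto simp: timed_edge_def)

lemma node_diff_timed_edge:
  "node_diff v (timed_edge e t) = v (snd e, Level t) - v (fst e, Level (t - 1))"
  by (simp add: node_diff_def timed_edge_def)

lemma parcs_ext_graph_Omega:
  "parcs (ext_graph_Omega G T) =
     {timed_edge e t | e t. e \<in> parcs G \<and> t \<in> {1..T}} \<union>
     {((x, Level t), (x, Omega)) | x t. x \<in> pverts G \<and> t \<in> {1..T}}"
  by (simp add: ext_graph_Omega_def ext_graph_def)

lemma parcs_ext_graph_Omega_Suc:
  "parcs (ext_graph_Omega G (Suc T)) =
     parcs (ext_graph_Omega G T) \<union> (\<lambda>e. timed_edge e (Suc T)) ` parcs G \<union>
     (\<lambda>x. ((x, Level (Suc T)), (x, Omega))) ` pverts G"
  unfolding parcs_ext_graph_Omega by (fastforce simp: le_Suc_eq)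

lemma pverts_ext_graph_Omega:
  "pverts (ext_graph_Omega G T) = pverts G \<times> insert Omega (Level ` {0..T})"
  by (auto simp: ext_graph_Omega_def ext_graph_def)

lemma (in pair_wf_digraph) pair_wf_digraph_ext_graph_Omega:
  "pair_wf_digraph (ext_graph_Omega G T)"
proof
  fix e assume "e \<in> parcs (ext_graph_Omega G T)"
  then show "fst e \<in> pverts (ext_graph_Omega G T)" "snd e \<in> pverts (ext_graph_Omega G T)"
    by (auto simp: parcs_ext_graph_Omega pverts_ext_graph_Omega timed_edge_def
        dest: wellformed')
qed

text \<open>Every arc moves to a strictly later stage, with \<open>Omega\<close> counted as
  last.\<close>

lemma swap_notin_parcs_ext_graph_Omega:
  assumes "a \<in> parcs (ext_graph_Omega G T)"
  shows "prod.swap a \<notin> parcs (ext_graph_Omega G T)"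
  using assms by (auto simp: parcs_ext_graph_Omega timed_edge_def)

section \<open>Symmetrization and complementarity\<close>

lemma pair_wf_digraph_sym_graph:
  assumes "pair_wf_digraph G" "S \<subseteq> parcs G"
  shows "pair_wf_digraph (sym_graph S G)"
proof -
  interpret pair_wf_digraph G by fact
  show ?thesis
    using assms(2) by unfold_locales (fastforce simp: sym_graph_def dest: wellformed')+
qed

text \<open>Absence of antiparallel arcs ensures that \<open>sym_fun\<close> really takes the value
  \<open>- \<xi> a\<close> on the reversal of \<open>a\<close>; this turns the inequality into an
  equality where \<open>i\<close> is positive.\<close>

lemma feasible_potential_sym_iff:
  assumes "\<And>a. a \<in> parcs G \<Longrightarrow> prod.swap a \<notin> parcs G" "\<And>a. a \<in> parcs G \<Longrightarrow> i a \<ge> 0"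
  defines "S \<equiv> {a \<in> parcs G. i a > 0}"
  shows "pre_digraph.feasible_potential (with_proj (sym_graph S G)) (sym_fun S G \<xi>) v \<longleftrightarrow>
    (\<forall>a\<in>parcs G. min (i a) (\<xi> a - node_diff v a) = 0)"
proof -
  have arc: "sym_fun S G \<xi> a = \<xi> a" if "a \<in> parcs G" for a
    using that by (simp add: sym_fun_def sym_graph_def)
  have rev: "sym_fun S G \<xi> (prod.swap a) = - \<xi> a" if "a \<in> S" for a
    using that assms(1) by (auto simp: sym_fun_def sym_graph_def S_def)
  have "pre_digraph.feasible_potential (with_proj (sym_graph S G)) (sym_fun S G \<xi>) v \<longleftrightarrow>
      (\<forall>a\<in>parcs G. node_diff v a \<le> \<xi> a) \<and> (\<forall>a\<in>S. - node_diff v a \<le> - \<xi> a)"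
    by (auto simp: pre_digraph.feasible_potential_def sym_graph_def[of S G] ball_Un arc rev
        node_diff_def)
  also have "\<dots> \<longleftrightarrow> (\<forall>a\<in>parcs G. min (i a) (\<xi> a - node_diff v a) = 0)"
  proof -
    have "min (i a) (\<xi> a - node_diff v a) = 0 \<longleftrightarrow>
        node_diff v a \<le> \<xi> a \<and> (i a > 0 \<longrightarrow> - node_diff v a \<le> - \<xi> a)" if "a \<in> parcs G" for a
      using assms(2)[OF that] by (auto simp: min_def)
    then show ?thesis by (auto simp: S_def)
  qed
  finally show ?thesis .
qed

section \<open>Partial derivatives of the total potential\<close>

text \<open>Both functions have the same set of derivatives, so the choice operator in
  \<open>vector_derivative\<close> returns the same value even when that set is empty.\<close>

lemma vector_derivative_add_const:
  "vector_derivative (\<lambda>s. f s + c) F = vector_derivative f F"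
proof -
  have "((\<lambda>s. f s + c) has_vector_derivative D) F \<longleftrightarrow> (f has_vector_derivative D) F" for D
    using has_vector_derivative_add[OF _ has_vector_derivative_const, of f D F c]
      has_vector_derivative_add[OF _ has_vector_derivative_const, of "\<lambda>s. f s + c" D F "- c"]
    by auto
  then show ?thesis by (simp add: vector_derivative_def)
qed

lemma slice_fun_upd:
  assumes "e \<in> parcs G"
  shows "slice G (i(timed_edge e t := s)) t' = (if t' = t then (slice G i t)(e := s) else slice G i t')"
  using assms by (auto simp: slice_def fun_eq_iff)

text \<open>Only the summand at time \<open>t\<close> sees this coordinate; the rest is an additive
  constant.\<close>

lemma partial_deriv_total_potential_timed_edge:
  assumes "e \<in> parcs G" "t \<in> {1..T}"
  shows "partial_deriv (total_potential G H T) i (timed_edge e t) =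
    partial_deriv (\<lambda>f. H f t) (slice G i t) e"
proof -
  have "total_potential G H T (i(timed_edge e t := s)) =
      H ((slice G i t)(e := s)) t + (\<Sum>t'\<in>{1..T} - {t}. H (slice G i t') t')" for s
    using assms(2) by (simp add: total_potential_def sum.remove[of _ t] slice_fun_upd[OF assms(1)])
  moreover have "slice G i t e = i (timed_edge e t)"
    using assms(1) by (simp add: slice_def)
  ultimately show ?thesis
    by (simp add: partial_deriv_def vector_derivative_add_const)
qed

text \<open>Slices never read arcs into \<open>Omega\<close>, so a constant is being differentiated.
  Nonnegativity makes the base point a limit point of \<open>{0..}\<close>, where the derivative is
  unique.\<close>

lemma partial_deriv_total_potential_Omega:
  assumes "i (p, (x, Omega)) \<ge> 0"
  shows "partial_deriv (total_potential G H T) i (p, (x, Omega)) = 0"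
proof -
  let ?r = "i (p, (x, Omega))"
  have "slice G (i((p, (x, Omega)) := s)) t = slice G i t" for s t
    by (auto simp: slice_def)
  then have "partial_deriv (total_potential G H T) i (p, (x, Omega)) =
      vector_derivative (\<lambda>s. total_potential G H T i) (at ?r within {0..})"
    by (simp add: partial_deriv_def total_potential_def)
  also have "\<dots> = 0"
  proof (rule vector_derivative_within)
    have "?r islimpt {0..}"
      by (rule islimpt_subset[of _ "{?r..?r + 1}"]) (use assms in \<open>auto intro: islimpt_Icc\<close>)
    then show "at ?r within {0..} \<noteq> bot" by (simp add: trivial_limit_within)
  qed (rule has_vector_derivative_const)
  finally show ?thesis .
qed

section \<open>Appending one time level\<close>

theorem theorem4p10:
  fixes G :: "'a pair_pre_digraph"
    and T :: nat
    and H :: "('a \<times> 'a \<Rightarrow> real) \<Rightarrow> nat \<Rightarrow> real"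
    and i j \<xi> :: "('a \<times> stage) \<times> ('a \<times> stage) \<Rightarrow> real"
  assumes "pair_fin_digraph G"
    and "T \<ge> 1"
    and "time_dependent_potential G H"
    and "i \<in> parcs (ext_graph_Omega G T) \<rightarrow>\<^sub>E {0..}"
    and "\<exists>u \<in> pverts (ext_graph_Omega G T) \<rightarrow>\<^sub>E (UNIV :: real set).
           \<forall>e\<in>parcs (ext_graph_Omega G T).
             min (i e) (partial_deriv (total_potential G H T) i e - node_diff u e) = 0"
    and "\<forall>x\<in>pverts G. \<forall>t\<in>{1..T}. divergence (ext_graph_Omega G T) i (x, Level t) = 0"
    and "j = (\<lambda>e\<in>parcs (ext_graph_Omega G (T + 1)).
                if e \<in> parcs (ext_graph_Omega G T) then i e else 0)"
    and "\<xi> = (\<lambda>e\<in>parcs (ext_graph_Omega G (T + 1)).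
                partial_deriv (total_potential G H (T + 1)) j e)"
  shows
    "(\<exists>v \<in> pverts (ext_graph_Omega G (T + 1)) \<rightarrow>\<^sub>E (UNIV :: real set).
        \<forall>e\<in>parcs (ext_graph_Omega G (T + 1)).
          min (j e) (partial_deriv (total_potential G H (T + 1)) j e - node_diff v e) = 0)
     \<longleftrightarrow>
     (\<forall>k\<ge>1. \<forall>e :: nat \<Rightarrow> 'a \<times> 'a.
        (\<forall>l\<in>{1..k}. e l \<in> parcs G) \<and> e (k + 1) = e 1 \<longrightarrow>
        (\<Sum>l=1..k.
           ereal (partial_deriv (\<lambda>f. H f (T + 1)) (\<lambda>_\<in>parcs G. 0) (e l)) +
           graph_dist
             (sym_graph {a \<in> parcs (ext_graph_Omega G T). i a > 0} (ext_graph_Omega G T))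
             (sym_fun {a \<in> parcs (ext_graph_Omega G T). i a > 0} (ext_graph_Omega G T)
                (restrict \<xi> (parcs (ext_graph_Omega G T))))
             (snd (e l), Omega) (fst (e (l + 1)), Level T))
        \<ge> 0)"
proof -
  interpret G: pair_fin_digraph G by fact
  let ?E = "parcs (ext_graph_Omega G T)"
  let ?S = "{a \<in> ?E. i a > 0}"
  let ?A = "sym_graph ?S (ext_graph_Omega G T)"
  let ?\<zeta> = "sym_fun ?S (ext_graph_Omega G T) (restrict \<xi> ?E)"
  let ?w = "\<lambda>e. partial_deriv (\<lambda>f. H f (Suc T)) (\<lambda>_\<in>parcs G. 0) e"
  let ?opt = "\<lambda>v E. \<forall>a\<in>E. min (j a) (\<xi> a - node_diff v a) = 0"
  note j = assms(7)[folded Suc_eq_plus1] and \<xi> = assms(8)[folded Suc_eq_plus1]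
  interpret A: pair_wf_digraph ?A
    by (intro pair_wf_digraph_sym_graph G.pair_wf_digraph_ext_graph_Omega) auto
  have i_nonneg: "i a \<ge> 0" if "a \<in> ?E" for a
    using assms(4) that by auto
  have new_arc: "timed_edge e (Suc T) \<notin> ?E" "((x, Level (Suc T)), (x, Omega)) \<notin> ?E" for e x
    by (auto simp: parcs_ext_graph_Omega)
  have j_old: "j a = i a" if "a \<in> ?E" for a
    using that by (simp add: j parcs_ext_graph_Omega_Suc)
  have j_edge: "j (timed_edge e (Suc T)) = 0" if "e \<in> parcs G" for e
    using that new_arc by (auto simp: j parcs_ext_graph_Omega_Suc)
  have j_Omega: "j ((x, Level (Suc T)), (x, Omega)) = 0" if "x \<in> pverts G" for x
    using that new_arc by (auto simp: j parcs_ext_graph_Omega_Suc)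
  have slice_old: "slice G j t = slice G i t" if "t \<in> {1..T}" for t
    unfolding slice_def using that
    by (intro restrict_ext j_old) (auto simp: parcs_ext_graph_Omega)
  \<comment> \<open>This is the source of the zero argument in the derivatives of the
    criterion.\<close>
  have slice_new: "slice G j (Suc T) = (\<lambda>_\<in>parcs G. 0)"
    unfolding slice_def by (intro restrict_ext j_edge)
  \<comment> \<open>The summand at time \<open>T + 1\<close> ignores the old coordinates, so on old
    arcs \<open>\<xi>\<close> is the gradient for which a potential is given by hypothesis.\<close>
  have \<xi>_old: "\<xi> a = partial_deriv (total_potential G H T) i a" if a: "a \<in> ?E" for a
  proof -
    have "\<xi> a = partial_deriv (total_potential G H (Suc T)) j a"
      using a by (simp add: \<xi> parcs_ext_graph_Omega_Suc)
    also have "\<dots> = partial_deriv (total_potential G H T) i a"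
      using a i_nonneg[OF a] j_old[OF a] unfolding parcs_ext_graph_Omega
      by (auto simp: partial_deriv_total_potential_timed_edge slice_old
          partial_deriv_total_potential_Omega)
    finally show ?thesis .
  qed
  have \<xi>_edge: "\<xi> (timed_edge e (Suc T)) = ?w e" if "e \<in> parcs G" for e
  proof -
    have "timed_edge e (Suc T) \<in> parcs (ext_graph_Omega G (Suc T))"
      using that by (simp add: parcs_ext_graph_Omega_Suc)
    then have "\<xi> (timed_edge e (Suc T)) =
        partial_deriv (total_potential G H (Suc T)) j (timed_edge e (Suc T))"
      by (simp add: \<xi>)
    also have "\<dots> = ?w e"
      using that slice_new by (simp add: partial_deriv_total_potential_timed_edge)
    finally show ?thesis .
  qed
  have \<xi>_Omega: "\<xi> ((x, Level (Suc T)), (x, Omega)) = 0" if x: "x \<in> pverts G" for x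
  proof -
    have "((x, Level (Suc T)), (x, Omega)) \<in> parcs (ext_graph_Omega G (Suc T))"
      using x by (simp add: parcs_ext_graph_Omega_Suc)
    then show ?thesis
      using j_Omega[OF x] by (simp add: \<xi> partial_deriv_total_potential_Omega)
  qed
  have feasible_iff: "A.feasible_potential ?\<zeta> v \<longleftrightarrow> ?opt v ?E" for v
    using i_nonneg j_old
    by (subst feasible_potential_sym_iff[OF swap_notin_parcs_ext_graph_Omega]) auto
  obtain u where "\<forall>a\<in>?E. min (i a) (partial_deriv (total_potential G H T) i a - node_diff u a) = 0"
    using assms(5) by blast
  then have u: "A.feasible_potential ?\<zeta> u"
    by (simp add: feasible_iff j_old \<xi>_old)
  \<comment> \<open>On the new arcs \<open>j\<close> is zero, so complementarity there is only the
    inequality between \<open>node_diff v\<close> and \<open>\<xi>\<close>.\<close>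
  have opt_Suc: "?opt v (parcs (ext_graph_Omega G (Suc T))) \<longleftrightarrow>
      ?opt v ?E \<and> (\<forall>e\<in>parcs G. v (snd e, Level (Suc T)) - v (fst e, Level T) \<le> ?w e) \<and>
      (\<forall>x\<in>pverts G. v (x, Omega) \<le> v (x, Level (Suc T)))" for v
  proof -
    have "min 0 r = 0 \<longleftrightarrow> 0 \<le> r" for r :: real by (simp add: min_def)
    then show ?thesis
      unfolding parcs_ext_graph_Omega_Suc ball_Un ball_simps
      by (simp add: j_edge j_Omega \<xi>_edge \<xi>_Omega node_diff_timed_edge
          node_diff_def[of v "(p, q)" for p q])
  qed
  text \<open>
    The only arc leaving \<open>(y, T + 1)\<close> leads to \<open>(y, \<Omega>)\<close> and has weight zero, so the two nodes can be
    identified.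
  \<close>
  have contract: "(\<exists>v\<in>pverts (ext_graph_Omega G (Suc T)) \<rightarrow>\<^sub>E UNIV.
        ?opt v (parcs (ext_graph_Omega G (Suc T)))) \<longleftrightarrow>
      (\<exists>v. A.feasible_potential ?\<zeta> v \<and>
        (\<forall>e\<in>parcs G. v (snd e, Omega) - v (fst e, Level T) \<le> ?w e))"
    (is "?L \<longleftrightarrow> ?M")
  proof
    assume ?L
    then obtain v where v: "?opt v (parcs (ext_graph_Omega G (Suc T)))" by blast
    \<comment> \<open>The inequalities of the two consecutive new arcs through
      \<open>(snd e, Level (Suc T))\<close> are added.\<close>
    have "v (snd e, Omega) - v (fst e, Level T) \<le> ?w e" if "e \<in> parcs G" for e
      using v that G.arc_snd_in_verts[OF that] unfolding opt_Suc by fastforce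
    with v show ?M unfolding opt_Suc feasible_iff by blast
  next
    assume ?M
    then obtain v where v: "?opt v ?E"
      "\<forall>e\<in>parcs G. v (snd e, Omega) - v (fst e, Level T) \<le> ?w e"
      unfolding feasible_iff by blast
    \<comment> \<open>The new node \<open>(x, Level (Suc T))\<close> copies the value at
      \<open>(x, Omega)\<close>, which makes the arc between them tight; old nodes keep their
      values.\<close>
    define v' where "v' = (\<lambda>(x, \<tau>)\<in>pverts (ext_graph_Omega G (Suc T)).
      v (x, if \<tau> = Level (Suc T) then Omega else \<tau>))"
    have v': "v' (x, Omega) = v (x, Omega)" "v' (x, Level (Suc T)) = v (x, Omega)"
      "t \<le> T \<Longrightarrow> v' (x, Level t) = v (x, Level t)" if "x \<in> pverts G" for x t
      using that by (auto simp: v'_def pverts_ext_graph_Omega)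
    have "node_diff v' a = node_diff v a" if "a \<in> ?E" for a
      using that unfolding parcs_ext_graph_Omega atLeastAtMost_iff
      by (elim UnE CollectE exE conjE) (simp_all add: node_diff_timed_edge v'
          node_diff_def[of _ "(p, q)" for p q] G.arc_fst_in_verts G.arc_snd_in_verts)
    then have "?opt v' (parcs (ext_graph_Omega G (Suc T)))"
      unfolding opt_Suc using v by (simp add: v' G.arc_fst_in_verts G.arc_snd_in_verts)
    moreover have "v' \<in> pverts (ext_graph_Omega G (Suc T)) \<rightarrow>\<^sub>E UNIV"
      by (auto simp: v'_def)
    ultimately show ?L by blast
  qed
  \<comment> \<open>After contraction the new arcs end at nodes of the old graph, as the criterion
    for additional arcs requires.\<close>
  have "(\<lambda>e. (snd e, Omega)) ` parcs G \<subseteq> pverts ?A"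
    by (auto simp: sym_graph_def pverts_ext_graph_Omega dest: G.wellformed')
  note criterion = A.feasible_potential_extra_arcs_iff[OF G.pair_finite_arcs this u,
      where s = "\<lambda>e. (fst e, Level T)" and w = ?w]
  have "(\<exists>v\<in>pverts (ext_graph_Omega G (Suc T)) \<rightarrow>\<^sub>E (UNIV :: real set).
        \<forall>e\<in>parcs (ext_graph_Omega G (Suc T)).
          min (j e) (partial_deriv (total_potential G H (Suc T)) j e - node_diff v e) = 0) \<longleftrightarrow>
      (\<exists>v\<in>pverts (ext_graph_Omega G (Suc T)) \<rightarrow>\<^sub>E UNIV.
        ?opt v (parcs (ext_graph_Omega G (Suc T))))"
    by (simp add: \<xi>)
  from this[unfolded contract criterion] show ?thesis
    unfolding graph_dist_def Suc_eq_plus1 .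
qed

end
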